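(* Let $\mathbb T$ be a time scale, let $f,g:\mathbb T\to\mathbb R$ be functions symmetric differentiable at $t\in\mathbb T_\kappa^\kappa$ and let $\lambda\in\mathbb R$. Then: 1. $f+g$ is symmetric differentiable at $t$ with $(f+g)^\diamondsuit(t)=f^\diamondsuit(t)+g^\diamondsuit(t)$; 2. $\lambda f$ is symmetric differentiable at $t$ with $(\lambda f)^\diamondsuit(t)=\lambda f^\diamondsuit(t)$; 3. $fg$ is symmetric differentiable at $t$ with $(fg)^\diamondsuit(t)=f^\diamondsuit(t)g^\sigma(t)+f^\rho(t)g^\diamondsuit(t)$, provided that $f$ and $g$ are continuous; 4. $\frac1f$ is symmetric differentiable at $t$ with $$\left(\frac1f\right)^\diamondsuit(t)=-\frac{f^\diamondsuit(t)}{f^\sigma(t)f^\rho(t)},$$ provided that $f$ is continuous and $f^\sigma(t)f^\rho(t)\ne0$; 5. $\frac fg$ is symmetric differentiable at $t$ with $$\left(\frac fg\right)^\diamondsuit(t)=\frac{f^\diamondsuit(t)g^\rho(t)-f^\rho(t)g^\diamondsuit(t)}{g^\sigma(t)g^\rho(t)},$$ provided that $f$ and $g$ are continuous and $g^\sigma(t)g^\rho(t)\ne0$.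
   Context: A time scale $\mathbb T$ is a nonempty closed subset of $\mathbb R$ (with the relative topology; neighborhoods are in $\mathbb T$). $\sigma(t)=\inf\{s\in\mathbb T:s>t\}$ and $\rho(t)=\sup\{s\in\mathbb T:s<t\}$, with $\inf\emptyset=\sup\mathbb T$ and $\sup\emptyset=\inf\mathbb T$. $\mathbb T^\kappa$ is $\mathbb T$ minus its maximum if the maximum exists and is left-scattered ($\rho(\max)<\max$), otherwise $\mathbb T$; $\mathbb T_\kappa$ is $\mathbb T$ minus its minimum if the minimum exists and is right-scattered ($\sigma(\min)>\min$), otherwise $\mathbb T$; $\mathbb T_\kappa^\kappa=\mathbb T_\kappa\cap\mathbb T^\kappa$. $f^\sigma=f\circ\sigma$, $f^\rho=f\circ\rho$. Symmetric derivative: $f^\diamondsuit(t)$, $t\in\mathbb T_\kappa^\kappa$, is the real number (if it exists; then $f$ is symmetric differentiable at $t$) such that for every $\varepsilon>0$ there is a neighborhood $U$ of $t$ such that, for all $s\in U$ for which $2t-s\in U$, $$\left|[f^\sigma(t)-f(s)+f(2t-s)-f^\rho(t)]-f^\diamondsuit(t)[\sigma(t)+2t-2s-\rho(t)]\right|\le\varepsilon\left|\sigma(t)+2t-2s-\rho(t)\right|.$$ *)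

theory Defs
  imports "HOL-Analysis.Analysis"
begin

definition time_scale :: "real set \<Rightarrow> bool" where
  "time_scale T \<longleftrightarrow> T \<noteq> {} \<and> closed T"

(* The case distinctions implement inf {} = sup T and sup {} = inf T.  For t in T the
   remaining infima and suprema are of nonempty sets with the bound t. *)
definition forward_jump :: "real set \<Rightarrow> real \<Rightarrow> real" where
  "forward_jump T t = (if \<exists>s\<in>T. s > t then Inf {s \<in> T. s > t} else Sup T)"

definition backward_jump :: "real set \<Rightarrow> real \<Rightarrow> real" where
  "backward_jump T t = (if \<exists>s\<in>T. s < t then Sup {s \<in> T. s < t} else Inf T)"

(* The subtracted sets contain at most the maximum (minimum) of T. *)
definition upper_kappa :: "real set \<Rightarrow> real set" where
  "upper_kappa T = T - {m \<in> T. (\<forall>s\<in>T. s \<le> m) \<and> backward_jump T m < m}"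

definition lower_kappa :: "real set \<Rightarrow> real set" where
  "lower_kappa T = T - {m \<in> T. (\<forall>s\<in>T. m \<le> s) \<and> forward_jump T m > m}"

(* A function T -> R is represented by a total function of which only the values on T
   matter.  "D is a symmetric derivative of f at t" is a relation, as for has_derivative,
   because the defining condition need not determine D (for example T = {0..1}, t = 0);
   see has_sym_derivative_nonunique below. *)
definition has_sym_derivative :: "real set \<Rightarrow> (real \<Rightarrow> real) \<Rightarrow> real \<Rightarrow> real \<Rightarrow> bool" where
  "has_sym_derivative T f D t \<longleftrightarrow>
     (\<forall>\<epsilon>>0. \<exists>U. openin (top_of_set T) U \<and> t \<in> U \<and>
        (\<forall>s\<in>U. 2 * t - s \<in> U \<longrightarrow>
           \<bar>(f (forward_jump T t) - f s + f (2 * t - s) - f (backward_jump T t))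
             - D * (forward_jump T t + 2 * t - 2 * s - backward_jump T t)\<bar>
           \<le> \<epsilon> * \<bar>forward_jump T t + 2 * t - 2 * s - backward_jump T t\<bar>))"

(* Uniqueness depends on T and t only: if it fails for one function at t, then every
   real number is a symmetric derivative of every function at t. *)
lemma has_sym_derivative_nonunique:
  assumes D: "has_sym_derivative T f D t" and D': "has_sym_derivative T f D' t"
    and "D \<noteq> D'"
  shows "has_sym_derivative T h E t"
proof -
  define w where "w s = forward_jump T t + 2 * t - 2 * s - backward_jump T t" for s
  define F where "F s = f (forward_jump T t) - f s + f (2 * t - s) - f (backward_jump T t)" for s
  define e where "e = \<bar>D - D'\<bar> / 4"
  have e: "e > 0" using \<open>D \<noteq> D'\<close> by (simp add: e_def)
  obtain U where U: "openin (top_of_set T) U" "t \<in> U"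
    "\<And>s. s \<in> U \<Longrightarrow> 2 * t - s \<in> U \<Longrightarrow> \<bar>F s - D * w s\<bar> \<le> e * \<bar>w s\<bar>"
    using D e unfolding has_sym_derivative_def w_def F_def by metis
  obtain V where V: "openin (top_of_set T) V" "t \<in> V"
    "\<And>s. s \<in> V \<Longrightarrow> 2 * t - s \<in> V \<Longrightarrow> \<bar>F s - D' * w s\<bar> \<le> e * \<bar>w s\<bar>"
    using D' e unfolding has_sym_derivative_def w_def F_def by metis
  have w0: "w s = 0" if "s \<in> U \<inter> V" "2 * t - s \<in> U \<inter> V" for s
  proof -
    have "\<bar>D - D'\<bar> * \<bar>w s\<bar> = \<bar>(F s - D' * w s) - (F s - D * w s)\<bar>"
      by (simp add: abs_mult [symmetric] algebra_simps)
    also have "\<dots> \<le> 2 * e * \<bar>w s\<bar>"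
      using U(3)[of s] V(3)[of s] that by auto
    finally have "4 * e * \<bar>w s\<bar> \<le> 2 * e * \<bar>w s\<bar>" by (simp add: e_def)
    then have "e * \<bar>w s\<bar> \<le> 0" by linarith
    then show ?thesis using e by (simp add: mult_le_0_iff)
  qed
  have "w t = 0" using w0[of t] U(2) V(2) by simp
  then have eq: "forward_jump T t = backward_jump T t" by (simp add: w_def)
  have st: "s = t" if "s \<in> U \<inter> V" "2 * t - s \<in> U \<inter> V" for s
    using w0[OF that] eq by (simp add: w_def)
  show ?thesis
    unfolding has_sym_derivative_def
  proof (intro allI impI exI conjI ballI)
    show "openin (top_of_set T) (U \<inter> V)" using U(1) V(1) by (rule openin_Int)
    show "t \<in> U \<inter> V" using U(2) V(2) by simp
  next
    fix \<epsilon> :: real and s assume "s \<in> U \<inter> V" "2 * t - s \<in> U \<inter> V"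
    then have "s = t" by (rule st)
    then show "\<bar>(h (forward_jump T t) - h s + h (2 * t - s) - h (backward_jump T t))
             - E * (forward_jump T t + 2 * t - 2 * s - backward_jump T t)\<bar>
           \<le> \<epsilon> * \<bar>forward_jump T t + 2 * t - 2 * s - backward_jump T t\<bar>"
      using eq by simp
  qed
qed

end

theory Submission
  imports Defs
begin

text \<open>
  Unless \<open>\<sigma>(t) = t = \<rho>(t)\<close>, the only point \<open>s\<close> near \<open>t\<close> with \<open>s\<close> and \<open>2t - s\<close> both in the time
  scale is \<open>t\<close> itself, so the symmetric derivative is given by the single equation
  \<open>f(\<sigma>(t)) - f(\<rho>(t)) = D (\<sigma>(t) - \<rho>(t))\<close>. If \<open>\<sigma>(t) = t = \<rho>(t)\<close>, it is the limit of the symmetric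
  difference quotients. In both cases the rules are those of ordinary algebra and of limits.
\<close>

section \<open>Order bounds for the jump operators\<close>

lemma forward_jump_ge:
  assumes "t \<in> T"
  shows "t \<le> forward_jump T t"
proof (cases "\<exists>s\<in>T. s > t")
  case True
  then show ?thesis
    unfolding forward_jump_def by (auto intro!: cInf_greatest)
next
  case False
  \<comment> \<open>Here \<open>t\<close> is the maximum of \<open>T\<close>, so the default value
    \<open>Sup T\<close> of the jump is \<open>t\<close> itself.\<close>
  then have "Sup T = t"
    using assms by (intro cSup_eq_maximum) force+
  then show ?thesis using False by (simp add: forward_jump_def)
qed

lemma backward_jump_le:
  assumes "t \<in> T"
  shows "backward_jump T t \<le> t"
proof (cases "\<exists>s\<in>T. s < t")
  case True
  then show ?thesis
    unfolding backward_jump_def by (auto intro!: cSup_least)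
next
  case False
  then have "Inf T = t"
    using assms by (intro cInf_eq_minimum) force+
  then show ?thesis using False by (simp add: backward_jump_def)
qed

text \<open>Serves, with its mirror image below, to show that no point of \<open>T\<close> lies
  strictly between \<open>t\<close> and either jump. This gap is what rules out reflected
  pairs.\<close>

lemma forward_jump_le:
  assumes "s \<in> T" "t < s"
  shows "forward_jump T t \<le> s"
  using assms unfolding forward_jump_def
  by (auto intro!: cInf_lower bdd_belowI[of _ t])

lemma backward_jump_ge:
  assumes "s \<in> T" "s < t"
  shows "s \<le> backward_jump T t"
  using assms unfolding backward_jump_def
  by (auto intro!: cSup_upper bdd_aboveI[of _ t])

section \<open>Reduction of the symmetric derivative to an equation or a limit\<close>

definition reflectable :: "real set \<Rightarrow> real \<Rightarrow> real set" where
  "reflectable T t = {s \<in> T. 2 * t - s \<in> T}"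

text \<open>At \<open>s = t\<close> the weight is the fixed positive number
  \<open>forward_jump T t - backward_jump T t\<close>, so shrinking \<epsilon> turns the inequality
  into an equation. Conversely, the equation makes the error at \<open>s = t\<close> vanish, and a
  suitable neighbourhood admits no other \<open>s\<close>.\<close>

lemma has_sym_derivative_scattered_iff:
  assumes t: "t \<in> T" and ne: "\<not> (forward_jump T t = t \<and> backward_jump T t = t)"
  shows "has_sym_derivative T f D t \<longleftrightarrow>
    f (forward_jump T t) - f (backward_jump T t) = D * (forward_jump T t - backward_jump T t)"
    (is "_ \<longleftrightarrow> ?eq")
proof
  define w where "w = forward_jump T t - backward_jump T t"
  assume D: "has_sym_derivative T f D t"
  have bound: "\<bar>f (forward_jump T t) - f (backward_jump T t) - D * w\<bar> \<le> \<epsilon> * \<bar>w\<bar>" if "\<epsilon> > 0" for \<epsilon>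
  proof -
    from D that obtain U where U: "t \<in> U" and
      "\<forall>s\<in>U. 2 * t - s \<in> U \<longrightarrow>
           \<bar>(f (forward_jump T t) - f s + f (2 * t - s) - f (backward_jump T t))
             - D * (forward_jump T t + 2 * t - 2 * s - backward_jump T t)\<bar>
           \<le> \<epsilon> * \<bar>forward_jump T t + 2 * t - 2 * s - backward_jump T t\<bar>"
      unfolding has_sym_derivative_def by meson
    from bspec[OF this(2) U] U show ?thesis
      by (simp add: w_def)
  qed
  have w: "w > 0"
    using ne forward_jump_ge[OF t] backward_jump_le[OF t] by (auto simp: w_def)
  \<comment> \<open>The choice \<open>e / w\<close> cancels the weight \<open>w\<close>;
    \<open>0 + e\<close> is the shape that \<open>field_le_epsilon\<close> expects.\<close>
  have "\<bar>f (forward_jump T t) - f (backward_jump T t) - D * w\<bar> \<le> 0 + e" if "e > 0" for e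
    using bound[of "e / w"] w that by simp
  then have "\<bar>f (forward_jump T t) - f (backward_jump T t) - D * w\<bar> \<le> 0"
    by (rule field_le_epsilon)
  then show ?eq unfolding w_def by linarith
next
  assume eq: ?eq
  \<comment> \<open>Cutting at a jump that differs from \<open>t\<close> leaves no point of
    \<open>U\<close> on that side of \<open>t\<close>. If \<open>s\<close> is not \<open>t\<close>,
    one of \<open>s\<close> and \<open>2 * t - s\<close> would lie on that side.\<close>
  define U where "U = T \<inter> (if t < forward_jump T t then {..<forward_jump T t}
                            else {backward_jump T t<..})"
  have U: "openin (top_of_set T) U"
    unfolding U_def by (rule openin_open_Int) simp
  have tU: "t \<in> U"
    using t ne forward_jump_ge[OF t] backward_jump_le[OF t] by (auto simp: U_def)
  have st: "s = t" if "s \<in> U" "2 * t - s \<in> U" for s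
    using that forward_jump_le[of s T t] forward_jump_le[of "2 * t - s" T t]
      backward_jump_ge[of s T t] backward_jump_ge[of "2 * t - s" T t]
    by (cases s t rule: linorder_cases) (auto simp: U_def split: if_splits)
  show "has_sym_derivative T f D t"
    unfolding has_sym_derivative_def
  proof (intro allI impI exI[of _ U] conjI ballI U tU)
    fix \<epsilon> :: real and s
    assume "\<epsilon> > 0" "s \<in> U" "2 * t - s \<in> U"
    then have "s = t" by (intro st)
    then show "\<bar>(f (forward_jump T t) - f s + f (2 * t - s) - f (backward_jump T t))
             - D * (forward_jump T t + 2 * t - 2 * s - backward_jump T t)\<bar>
           \<le> \<epsilon> * \<bar>forward_jump T t + 2 * t - 2 * s - backward_jump T t\<bar>"
      using eq \<open>\<epsilon> > 0\<close> by simp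
  qed
qed

text \<open>Dividing by the weight \<open>2 * t - 2 * s\<close> turns the inequality into closeness
  of the quotient to \<open>D\<close>; at \<open>s = t\<close> both sides are 0. Only points of
  \<open>reflectable T t\<close> are ever tested. If \<open>t\<close> is not a limit point of that
  set, the filter is trivial and both conditions hold for every \<open>D\<close>.\<close>

lemma has_sym_derivative_dense_iff:
  assumes t: "t \<in> T" and eq: "forward_jump T t = t" "backward_jump T t = t"
  shows "has_sym_derivative T f D t \<longleftrightarrow>
    ((\<lambda>s. (f (2 * t - s) - f s) / (2 * t - 2 * s)) \<longlongrightarrow> D) (at t within reflectable T t)"
    (is "_ \<longleftrightarrow> (?q \<longlongrightarrow> D) ?F")
proof -
  have quot: "\<bar>a - D * w\<bar> \<le> \<epsilon> * \<bar>w\<bar> \<longleftrightarrow> dist (a / w) D \<le> \<epsilon>" if "w \<noteq> 0" for a w \<epsilon> :: real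
  proof -
    have "a / w - D = (a - D * w) / w"
      using that by (simp add: diff_divide_distrib)
    then have "dist (a / w) D = \<bar>a - D * w\<bar> / \<bar>w\<bar>"
      by (simp add: dist_real_def abs_divide)
    then show ?thesis using that by (simp add: pos_divide_le_eq)
  qed
  have cancel: "f t - f s + f (2 * t - s) - f t = f (2 * t - s) - f s"
    "t + 2 * t - 2 * s - t = 2 * t - 2 * s" for s
    by simp_all
  show ?thesis
  proof
    assume D: "has_sym_derivative T f D t"
    show "(?q \<longlongrightarrow> D) ?F"
    proof (rule tendstoI)
      fix e :: real assume "e > 0"
      \<comment> \<open>Halving \<open>e\<close> leaves room for the strict inequality in the
        definition of the limit.\<close>
      then obtain U where U: "openin (top_of_set T) U" "t \<in> U" and
        bound: "\<And>s. s \<in> U \<Longrightarrow> 2 * t - s \<in> U \<Longrightarrow>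
          \<bar>f (2 * t - s) - f s - D * (2 * t - 2 * s)\<bar> \<le> e / 2 * \<bar>2 * t - 2 * s\<bar>"
        using D[unfolded has_sym_derivative_def eq cancel, rule_format, of "e / 2"] by auto
      obtain d where d: "d > 0" "ball t d \<inter> T \<subseteq> U"
        using U openin_contains_ball by metis
      have "dist (?q s) D < e" if "s \<in> reflectable T t" "s \<noteq> t" "dist s t < d" for s
      proof -
        have "s \<in> U" "2 * t - s \<in> U"
          using that d(2) by (auto simp: reflectable_def subset_iff dist_real_def)
        from bound[OF this] have "dist (?q s) D \<le> e / 2"
          using that(2) by (subst (asm) quot) auto
        with \<open>e > 0\<close> show ?thesis by linarith
      qed
      with d(1) show "\<forall>\<^sub>F s in ?F. dist (?q s) D < e"
        unfolding eventually_at by blast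
    qed
  next
    assume lim: "(?q \<longlongrightarrow> D) ?F"
    show "has_sym_derivative T f D t"
      unfolding has_sym_derivative_def eq cancel
    proof (intro allI impI)
      fix \<epsilon> :: real assume "\<epsilon> > 0"
      then obtain d where d: "d > 0" and
        close: "\<And>s. s \<in> reflectable T t \<Longrightarrow> s \<noteq> t \<Longrightarrow> dist s t < d \<Longrightarrow> dist (?q s) D < \<epsilon>"
        using tendstoD[OF lim, of \<epsilon>] unfolding eventually_at by auto
      have "\<bar>f (2 * t - s) - f s - D * (2 * t - 2 * s)\<bar> \<le> \<epsilon> * \<bar>2 * t - 2 * s\<bar>"
        if "s \<in> T \<inter> ball t d" "2 * t - s \<in> T \<inter> ball t d" for s
      proof (cases "s = t")
        case False
        with that close[of s] show ?thesis
          by (simp add: quot reflectable_def dist_commute less_imp_le)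
      qed simp
      then show "\<exists>U. openin (top_of_set T) U \<and> t \<in> U \<and> (\<forall>s\<in>U. 2 * t - s \<in> U \<longrightarrow>
          \<bar>f (2 * t - s) - f s - D * (2 * t - 2 * s)\<bar> \<le> \<epsilon> * \<bar>2 * t - 2 * s\<bar>)"
        using d t by (intro exI[of _ "T \<inter> ball t d"]) (simp add: openin_open_Int)
    qed
  qed
qed

text \<open>Reflection about \<open>t\<close> maps \<open>reflectable T t\<close> into
  \<open>T\<close>, moves no other point to \<open>t\<close>, and tends to \<open>t\<close>; hence
  it can be composed with the limit within \<open>T\<close>.\<close>

lemma tendsto_reflectable:
  assumes "continuous (at t within T) f"
  shows "(f \<longlongrightarrow> f t) (at t within reflectable T t)"
    and "((\<lambda>s. f (2 * t - s)) \<longlongrightarrow> f t) (at t within reflectable T t)"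
proof -
  have lim: "(f \<longlongrightarrow> f t) (at t within T)"
    using assms by (simp add: continuous_within)
  show "(f \<longlongrightarrow> f t) (at t within reflectable T t)"
    by (rule tendsto_within_subset[OF lim]) (auto simp: reflectable_def)
  have "((\<lambda>s. 2 * t - s) \<longlongrightarrow> 2 * t - t) (at t within reflectable T t)"
    by (intro tendsto_intros)
  then have "filterlim (\<lambda>s. 2 * t - s) (at t within T) (at t within reflectable T t)"
    unfolding filterlim_at by (auto simp: eventually_at_filter reflectable_def)
  then show "((\<lambda>s. f (2 * t - s)) \<longlongrightarrow> f t) (at t within reflectable T t)"
    by (rule filterlim_compose[OF lim])
qed

section \<open>Differentiation rules\<close>

lemma has_sym_derivative_add:
  assumes "t \<in> T" "has_sym_derivative T f f' t" "has_sym_derivative T g g' t"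
  shows "has_sym_derivative T (\<lambda>s. f s + g s) (f' + g') t"
proof (cases "forward_jump T t = t \<and> backward_jump T t = t")
  case True
  then have "((\<lambda>s. (f (2 * t - s) - f s) / (2 * t - 2 * s) + (g (2 * t - s) - g s) / (2 * t - 2 * s))
      \<longlongrightarrow> f' + g') (at t within reflectable T t)"
    using assms by (intro tendsto_add) (simp_all add: has_sym_derivative_dense_iff)
  then show ?thesis
    using True assms(1)
    by (simp add: has_sym_derivative_dense_iff add_diff_add flip: add_divide_distrib)
next
  case False
  then show ?thesis
    using assms by (simp add: has_sym_derivative_scattered_iff add_diff_add distrib_right)
qed

lemma has_sym_derivative_cmult:
  assumes "t \<in> T" "has_sym_derivative T f f' t"
  shows "has_sym_derivative T (\<lambda>s. c * f s) (c * f') t"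
proof (cases "forward_jump T t = t \<and> backward_jump T t = t")
  case True
  then show ?thesis
    using assms tendsto_mult_left[of "\<lambda>s. (f (2 * t - s) - f s) / (2 * t - 2 * s)" f' _ c]
    by (simp add: has_sym_derivative_dense_iff right_diff_distrib)
next
  case False
  then show ?thesis
    using assms by (simp add: has_sym_derivative_scattered_iff flip: right_diff_distrib)
qed

text \<open>Continuity is stated conditionally so that the rule can be applied to
  \<open>1 / g\<close> in the quotient rule: at a scattered \<open>t\<close> the value
  \<open>g t\<close> may be 0.\<close>

lemma has_sym_derivative_mult:
  assumes t: "t \<in> T" and f: "has_sym_derivative T f f' t" and g: "has_sym_derivative T g g' t"
    and cont: "forward_jump T t = t \<Longrightarrow> backward_jump T t = t \<Longrightarrow>
      continuous (at t within T) f \<and> continuous (at t within T) g"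
  shows "has_sym_derivative T (\<lambda>s. f s * g s)
    (f' * g (forward_jump T t) + f (backward_jump T t) * g') t"
proof (cases "forward_jump T t = t \<and> backward_jump T t = t")
  case True
  then have eq: "forward_jump T t = t" "backward_jump T t = t" by auto
  let ?qf = "\<lambda>s. (f (2 * t - s) - f s) / (2 * t - 2 * s)"
  let ?qg = "\<lambda>s. (g (2 * t - s) - g s) / (2 * t - 2 * s)"
  \<comment> \<open>The mixed term \<open>f s * g (2 * t - s)\<close> is added and subtracted; this
    choice puts \<open>g\<close> at the forward and \<open>f\<close> at the backward jump in the
    formula.\<close>
  have "((\<lambda>s. ?qf s * g (2 * t - s) + f s * ?qg s) \<longlongrightarrow> f' * g t + f t * g')
      (at t within reflectable T t)"
    using f g cont t eq
    by (intro tendsto_intros tendsto_reflectable) (auto simp: has_sym_derivative_dense_iff)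
  moreover have "?qf s * g (2 * t - s) + f s * ?qg s
      = (f (2 * t - s) * g (2 * t - s) - f s * g s) / (2 * t - 2 * s)" for s
    by (simp add: add_divide_distrib[symmetric] algebra_simps)
  ultimately show ?thesis
    by (simp add: has_sym_derivative_dense_iff[OF t eq] eq)
next
  case False
  let ?\<sigma> = "forward_jump T t" and ?\<rho> = "backward_jump T t"
  have "f ?\<sigma> * g ?\<sigma> - f ?\<rho> * g ?\<rho> = (f ?\<sigma> - f ?\<rho>) * g ?\<sigma> + f ?\<rho> * (g ?\<sigma> - g ?\<rho>)"
    by (simp add: algebra_simps)
  also have "\<dots> = (f' * g ?\<sigma> + f ?\<rho> * g') * (?\<sigma> - ?\<rho>)"
    using f g unfolding has_sym_derivative_scattered_iff[OF t False]
    by (simp only: distrib_left distrib_right mult_ac)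
  finally show ?thesis
    unfolding has_sym_derivative_scattered_iff[OF t False] .
qed

text \<open>Both cases rest on \<open>1 / a - 1 / b = - ((a - b) / (a * b))\<close> for nonzero
  \<open>a\<close> and \<open>b\<close>, taken at the two jumps or at \<open>2 * t - s\<close> and
  \<open>s\<close>.\<close>

lemma has_sym_derivative_inverse:
  assumes t: "t \<in> T" and f: "has_sym_derivative T f f' t"
    and cont: "forward_jump T t = t \<Longrightarrow> backward_jump T t = t \<Longrightarrow> continuous (at t within T) f"
    and nz: "f (forward_jump T t) * f (backward_jump T t) \<noteq> 0"
  shows "has_sym_derivative T (\<lambda>s. 1 / f s)
    (- (f' / (f (forward_jump T t) * f (backward_jump T t)))) t"
proof (cases "forward_jump T t = t \<and> backward_jump T t = t")
  case True
  then have eq: "forward_jump T t = t" "backward_jump T t = t" by auto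
  let ?F = "at t within reflectable T t"
  let ?q = "\<lambda>s. (f (2 * t - s) - f s) / (2 * t - 2 * s)"
  have ft: "f t \<noteq> 0" using nz eq by simp
  note lim = tendsto_reflectable[OF cont[OF eq]]
  have "((\<lambda>s. - (?q s / (f (2 * t - s) * f s))) \<longlongrightarrow> - (f' / (f t * f t))) ?F"
    using f ft by (intro tendsto_intros lim) (auto simp: has_sym_derivative_dense_iff[OF t eq])
  \<comment> \<open>The identity needs nonzero values of \<open>f\<close>; near \<open>t\<close>
    they are nonzero because \<open>f s\<close> and \<open>f (2 * t - s)\<close> both tend to
    \<open>f t\<close>.\<close>
  moreover have "\<forall>\<^sub>F s in ?F. - (?q s / (f (2 * t - s) * f s))
      = (1 / f (2 * t - s) - 1 / f s) / (2 * t - 2 * s)"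
    using tendsto_imp_eventually_ne[OF lim(1) ft] tendsto_imp_eventually_ne[OF lim(2) ft]
  proof eventually_elim
    case (elim s)
    then have "1 / f (2 * t - s) - 1 / f s = - ((f (2 * t - s) - f s) / (f (2 * t - s) * f s))"
      by (simp add: divide_simps)
    then show ?case by simp
  qed
  ultimately have "((\<lambda>s. (1 / f (2 * t - s) - 1 / f s) / (2 * t - 2 * s))
      \<longlongrightarrow> - (f' / (f t * f t))) ?F"
    by (rule Lim_transform_eventually)
  then show ?thesis
    by (simp add: has_sym_derivative_dense_iff[OF t eq] eq)
next
  case False
  let ?\<sigma> = "forward_jump T t" and ?\<rho> = "backward_jump T t"
  have "1 / f ?\<sigma> - 1 / f ?\<rho> = - ((f ?\<sigma> - f ?\<rho>) / (f ?\<sigma> * f ?\<rho>))"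
    using nz by (simp add: divide_simps)
  then show ?thesis
    using f by (simp add: has_sym_derivative_scattered_iff[OF t False])
qed

text \<open>Follows from the product rule for \<open>f\<close> and \<open>1 / g\<close>.\<close>

lemma has_sym_derivative_divide:
  assumes t: "t \<in> T" and f: "has_sym_derivative T f f' t" and g: "has_sym_derivative T g g' t"
    and cont: "forward_jump T t = t \<Longrightarrow> backward_jump T t = t \<Longrightarrow>
      continuous (at t within T) f \<and> continuous (at t within T) g"
    and nz: "g (forward_jump T t) * g (backward_jump T t) \<noteq> 0"
  shows "has_sym_derivative T (\<lambda>s. f s / g s)
    ((f' * g (backward_jump T t) - f (backward_jump T t) * g')
      / (g (forward_jump T t) * g (backward_jump T t))) t"
proof -
  let ?\<sigma> = "forward_jump T t" and ?\<rho> = "backward_jump T t"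
  have "has_sym_derivative T (\<lambda>s. 1 / g s) (- (g' / (g ?\<sigma> * g ?\<rho>))) t"
    using t g cont nz by (intro has_sym_derivative_inverse) auto
  \<comment> \<open>When both jumps equal \<open>t\<close>, the assumption \<open>nz\<close> says
    that \<open>g t\<close> is nonzero, so \<open>1 / g\<close> is continuous there.\<close>
  moreover have "continuous (at t within T) f \<and> continuous (at t within T) (\<lambda>s. 1 / g s)"
    if "?\<sigma> = t" "?\<rho> = t"
    using cont[OF that] nz that by (auto simp: continuous_within intro!: tendsto_intros)
  ultimately have "has_sym_derivative T (\<lambda>s. f s * (1 / g s))
      (f' * (1 / g ?\<sigma>) + f ?\<rho> * - (g' / (g ?\<sigma> * g ?\<rho>))) t"
    by (intro has_sym_derivative_mult[OF t f])
  moreover have "f' * (1 / g ?\<sigma>) + f ?\<rho> * - (g' / (g ?\<sigma> * g ?\<rho>))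
      = (f' * g ?\<rho> - f ?\<rho> * g') / (g ?\<sigma> * g ?\<rho>)"
    using nz by (simp add: divide_simps)
  ultimately show ?thesis by simp
qed

theorem theorem8p2p13:
  fixes T :: "real set" and f g :: "real \<Rightarrow> real" and t c f' g' :: real
  assumes "time_scale T"
    and "t \<in> lower_kappa T \<inter> upper_kappa T"
    and "has_sym_derivative T f f' t"
    and "has_sym_derivative T g g' t"
  shows
    "has_sym_derivative T (\<lambda>s. f s + g s) (f' + g') t
     \<and> has_sym_derivative T (\<lambda>s. c * f s) (c * f') t
     \<and> (continuous_on T f \<and> continuous_on T g \<longrightarrow>
          has_sym_derivative T (\<lambda>s. f s * g s)
            (f' * g (forward_jump T t) + f (backward_jump T t) * g') t)
     \<and> (continuous_on T f \<and> f (forward_jump T t) * f (backward_jump T t) \<noteq> 0 \<longrightarrow>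
          has_sym_derivative T (\<lambda>s. 1 / f s)
            (- (f' / (f (forward_jump T t) * f (backward_jump T t)))) t)
     \<and> (continuous_on T f \<and> continuous_on T g \<and> g (forward_jump T t) * g (backward_jump T t) \<noteq> 0 \<longrightarrow>
          has_sym_derivative T (\<lambda>s. f s / g s)
            ((f' * g (backward_jump T t) - f (backward_jump T t) * g') / (g (forward_jump T t) * g (backward_jump T t))) t)"
proof -
  have t: "t \<in> T" using assms(2) by (simp add: upper_kappa_def)
  note f = assms(3) and g = assms(4)
  have cont: "continuous (at t within T) h" if "continuous_on T h" for h :: "real \<Rightarrow> real"
    using that t by (simp add: continuous_on_eq_continuous_within)
  show ?thesis
    using has_sym_derivative_add[OF t f g] has_sym_derivative_cmult[OF t f]
      has_sym_derivative_mult[OF t f g] has_sym_derivative_inverse[OF t f]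
      has_sym_derivative_divide[OF t f g] cont[of f] cont[of g]
    by blast
qed

end
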